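(* Let $k \ge 2$ be an integer and let $G = (V,E)$ be a graph with $\delta(G) \ge k + 1$. (i) If $G$ is $k$-connected, then $G$ contains a matching $M$ with $|M| = 2$ such that $G - M$ is $k$-connected. (ii) If $G$ is $k$-edge-connected, then $G$ contains a matching $M$ with $|M| = 2$ such that $G - M$ is $k$-edge-connected.
   Context: All graphs are finite, undirected and simple. $\delta(G)$ is the minimum degree of $G$. A matching is a set of pairwise vertex-disjoint edges. $G - M$ denotes the graph with vertex set $V$ and edge set $E \setminus M$. A graph is $k$-connected if it has at least $k+1$ vertices and remains connected after deleting any set of fewer than $k$ vertices; it is $k$-edge-connected if it remains connected after deleting any set of fewer than $k$ edges. *)

theory Defs
  imports Main
begin

text \<open>A graph is given by its vertex set \<open>V\<close> and its set \<open>E\<close> of edges, an edge being a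
  two-element subset of \<open>V\<close>; hence there are no loops or multiple edges.\<close>

definition simple_graph :: "'a set \<Rightarrow> 'a set set \<Rightarrow> bool" where
  "simple_graph V E \<longleftrightarrow> finite V \<and> (\<forall>e\<in>E. e \<subseteq> V \<and> card e = 2)"

definition vertex_degree :: "'a set set \<Rightarrow> 'a \<Rightarrow> nat" where
  "vertex_degree E v = card {e \<in> E. v \<in> e}"

text \<open>Unspecified for \<open>V = {}\<close>.\<close>

definition min_degree :: "'a set \<Rightarrow> 'a set set \<Rightarrow> nat" where
  "min_degree V E = Min (vertex_degree E ` V)"

definition matching :: "'a set set \<Rightarrow> 'a set set \<Rightarrow> bool" where
  "matching E M \<longleftrightarrow> M \<subseteq> E \<and> pairwise disjnt M"

text \<open>The graph without vertices does not count as connected.\<close>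

definition graph_connected :: "'a set \<Rightarrow> 'a set set \<Rightarrow> bool" where
  "graph_connected V E \<longleftrightarrow>
     V \<noteq> {} \<and> (\<forall>u\<in>V. \<forall>v\<in>V. (u, v) \<in> {(x, y). {x, y} \<in> E}\<^sup>*)"

text \<open>Deleting a set of vertices also deletes all edges incident with it.\<close>

definition k_connected :: "nat \<Rightarrow> 'a set \<Rightarrow> 'a set set \<Rightarrow> bool" where
  "k_connected k V E \<longleftrightarrow>
     card V \<ge> k + 1 \<and>
     (\<forall>S. S \<subseteq> V \<and> card S < k \<longrightarrow> graph_connected (V - S) {e \<in> E. e \<inter> S = {}})"

definition k_edge_connected :: "nat \<Rightarrow> 'a set \<Rightarrow> 'a set set \<Rightarrow> bool" where
  "k_edge_connected k V E \<longleftrightarrow>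
     (\<forall>F. F \<subseteq> E \<and> card F < k \<longrightarrow> graph_connected V (E - F))"

end

theory Submission
  imports Defs
begin

text \<open>
  The two parts have different reasons.

  Edge connectivity. Write \<open>d(A)\<close> for the number of edges leaving \<open>A\<close>; it is submodular and
  posimodular, so two crossing cuts of minimum size produce smaller sets with minimum cuts
  (\<open>minimum_cuts_uncross\<close>). Hence no minimum cut separates two vertices of an inclusion-minimal
  set \<open>Z\<close> with a minimum cut, and an edge inside \<open>Z\<close> can be deleted. Degrees of at least
  \<open>k + 1\<close> force such sets to contain edges. If there are cuts of size \<open>k\<close>, one deletes an edge
  inside a minimal \<open>Z\<close> and an edge inside a minimal subset \<open>Y\<close> of the complement of \<open>Z\<close>: every
  set inside \<open>Y\<close> still has all its leaving edges after the first deletion, so \<open>Y\<close> is still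
  minimal. If all cuts have more than \<open>k\<close> edges, only cuts of size exactly \<open>k + 1\<close> that contain
  both deleted edges are dangerous. Cuts around a single vertex never contain two disjoint
  edges. For the other ones, the same minimality argument gives an edge \<open>e\<close> that lies in none of
  them, and then any edge disjoint from \<open>e\<close> can be deleted as well.

  Vertex connectivity. If deleting an edge \<open>ab\<close> destroys \<open>k\<close>-connectivity, then fewer than \<open>k\<close>
  vertices \<open>T\<close> separate a side \<open>L\<close> containing \<open>a\<close> from a side \<open>R\<close> containing \<open>b\<close>, except for the
  edge \<open>ab\<close> itself. Let \<open>bc\<close> be a second such edge, \<open>c \<noteq> a\<close>. If \<open>b\<close> has degree greater than \<open>k\<close>,
  then the side of \<open>c\<close> at \<open>bc\<close> is smaller than the side of \<open>b\<close> at \<open>ab\<close>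
  (\<open>critical_separations_cross\<close>). So walking along critical edges without turning back makes
  the side ahead shrink for ever, which is impossible. This is Mader's theorem that a cycle of
  critical edges contains a vertex of degree \<open>k\<close>, stated below for edge sets in which every
  covered vertex has degree at least two.

  Mader's theorem yields a first edge \<open>xy\<close>. Afterwards at most \<open>x\<close> and \<open>y\<close> have degree \<open>k\<close>, and the
  second edge has to be found among the edges avoiding \<open>x\<close> and \<open>y\<close>. Every vertex other than \<open>x\<close>
  and \<open>y\<close> is on at least \<open>k - 1\<close> of these edges, so for \<open>k \<ge> 3\<close> Mader's theorem applies again.
  For \<open>k = 2\<close> it can fail to apply only because some vertex \<open>w\<close> has exactly one neighbour outside
  \<open>{x, y}\<close>; then \<open>w\<close> is a common neighbour of \<open>x\<close> and \<open>y\<close>, and the shrinking argument is started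
  at \<open>w\<close> and confined to sides that avoid both \<open>x\<close> and \<open>y\<close>
  (\<open>delete_edge_common_neighbour\<close>).
\<close>

section \<open>Simple graphs\<close>

lemma simple_graph_edgeD:
  assumes "simple_graph V E" "{u, v} \<in> E"
  shows "u \<in> V" "v \<in> V" "u \<noteq> v"
  using assms unfolding simple_graph_def by (auto simp: card_insert_if)

lemma simple_graph_edgeE:
  assumes "simple_graph V E" "e \<in> E"
  obtains u v where "e = {u, v}" "u \<noteq> v" "u \<in> V" "v \<in> V"
proof -
  have "card e = 2" "e \<subseteq> V"
    using assms unfolding simple_graph_def by auto
  then show thesis
    using that by (auto simp: card_2_iff)
qed

lemma simple_graph_subset:
  "simple_graph V E \<Longrightarrow> E' \<subseteq> E \<Longrightarrow> simple_graph V E'"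
  unfolding simple_graph_def by blast

lemma simple_graph_finite_edges:
  assumes "simple_graph V E"
  shows "finite E"
proof -
  have "E \<subseteq> Pow V" "finite V"
    using assms unfolding simple_graph_def by auto
  then show ?thesis
    using finite_subset by blast
qed

lemma vertex_degree_delete_other:
  "v \<notin> e \<Longrightarrow> vertex_degree (E - {e}) v = vertex_degree E v"
  unfolding vertex_degree_def by (rule arg_cong[where f = card]) auto

lemma exists_neighbour_outside:
  assumes "simple_graph V E" "finite B" "card B < vertex_degree E v"
  obtains u where "{v, u} \<in> E" "u \<notin> B" "u \<noteq> v" "u \<in> V"
proof -
  have "\<not> {e \<in> E. v \<in> e} \<subseteq> (\<lambda>u. {v, u}) ` B"
    using assms(2,3) card_mono[of "(\<lambda>u. {v, u}) ` B" "{e \<in> E. v \<in> e}"]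
      card_image_le[of B "\<lambda>u. {v, u}"]
    unfolding vertex_degree_def by fastforce
  then obtain e where e: "e \<in> E" "v \<in> e" "e \<notin> (\<lambda>u. {v, u}) ` B"
    by blast
  obtain p q where "e = {p, q}" "p \<noteq> q" "p \<in> V" "q \<in> V"
    using simple_graph_edgeE[OF assms(1) e(1)] .
  then obtain u where "e = {v, u}" "u \<noteq> v" "u \<in> V"
    using e(2) by auto
  then show thesis
    using that e by blast
qed

lemma exists_disjoint_edge:
  assumes G: "simple_graph V E" and "v \<in> V" "v \<noteq> x" "v \<noteq> y"
    and deg: "\<And>u. u \<in> V - {x, y} \<Longrightarrow> vertex_degree E u \<ge> 3"
  obtains u where "{v, u} \<in> E" "u \<noteq> x" "u \<noteq> y"
proof -
  have "card {x, y} < vertex_degree E v"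
    using deg[of v] assms(2-4) card_insert_le_m1[of 2 "{y}" x] by fastforce
  then show thesis
    using exists_neighbour_outside[OF G, of "{x, y}" v] that by blast
qed

lemma graph_connected_iff:
  assumes EV: "\<And>e. e \<in> E \<Longrightarrow> e \<subseteq> V"
  shows "graph_connected V E \<longleftrightarrow>
    V \<noteq> {} \<and> (\<forall>A. A \<subseteq> V \<and> A \<noteq> {} \<and> A \<noteq> V \<longrightarrow> (\<exists>u\<in>A. \<exists>v\<in>V - A. {u, v} \<in> E))"
proof (intro iffI conjI allI impI)
  assume con: "graph_connected V E"
  then show "V \<noteq> {}"
    unfolding graph_connected_def by blast
  fix A
  assume A: "A \<subseteq> V \<and> A \<noteq> {} \<and> A \<noteq> V"
  then obtain u w where uw: "u \<in> A" "w \<in> V" "w \<notin> A"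
    by blast
  show "\<exists>u\<in>A. \<exists>v\<in>V - A. {u, v} \<in> E"
  proof (rule ccontr)
    assume no: "\<not> ?thesis"
    have "(u, w) \<in> {(x, y). {x, y} \<in> E}\<^sup>*"
      using con A uw unfolding graph_connected_def by blast
    then have "w \<in> A"
    proof (induction rule: rtrancl_induct)
      case base
      show ?case using uw by blast
    next
      case (step y z)
      then show ?case using no EV[of "{y, z}"] by blast
    qed
    then show False using uw by blast
  qed
next
  assume R: "V \<noteq> {} \<and> (\<forall>A. A \<subseteq> V \<and> A \<noteq> {} \<and> A \<noteq> V \<longrightarrow> (\<exists>u\<in>A. \<exists>v\<in>V - A. {u, v} \<in> E))"
  show "graph_connected V E"
    unfolding graph_connected_def
  proof (intro conjI ballI)
    show "V \<noteq> {}" using R by blast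
    fix u v
    assume uv: "u \<in> V" "v \<in> V"
    define A where "A = {w \<in> V. (u, w) \<in> {(x, y). {x, y} \<in> E}\<^sup>*}"
    have "A = V"
    proof (rule ccontr)
      assume "A \<noteq> V"
      moreover have "u \<in> A" "A \<subseteq> V" using uv unfolding A_def by auto
      ultimately obtain p q where "p \<in> A" "q \<in> V - A" "{p, q} \<in> E"
        using R by blast
      then show False
        unfolding A_def by (auto intro: rtrancl_into_rtrancl)
    qed
    then show "(u, v) \<in> {(x, y). {x, y} \<in> E}\<^sup>*"
      using uv unfolding A_def by blast
  qed
qed

section \<open>Edge cuts\<close>

definition cut :: "'a set set \<Rightarrow> 'a set \<Rightarrow> 'a set set" where
  "cut E A = {e \<in> E. e \<inter> A \<noteq> {} \<and> \<not> e \<subseteq> A}"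

lemma finite_cut: "finite E \<Longrightarrow> finite (cut E A)"
  unfolding cut_def by simp

lemma cut_delete: "cut (E - F) A = cut E A - F"
  unfolding cut_def by blast

lemma cut_complement:
  assumes "simple_graph V E" "A \<subseteq> V"
  shows "cut E (V - A) = cut E A"
  using assms unfolding cut_def simple_graph_def by blast

lemma k_edge_connected_iff_cut:
  assumes G: "simple_graph V E" and "k > 0"
  shows "k_edge_connected k V E \<longleftrightarrow>
    V \<noteq> {} \<and> (\<forall>A. A \<subseteq> V \<and> A \<noteq> {} \<and> A \<noteq> V \<longrightarrow> k \<le> card (cut E A))"
proof -
  have con: "graph_connected V (E - F) \<longleftrightarrow> V \<noteq> {} \<and>
      (\<forall>A. A \<subseteq> V \<and> A \<noteq> {} \<and> A \<noteq> V \<longrightarrow> (\<exists>u\<in>A. \<exists>v\<in>V - A. {u, v} \<in> E - F))" for F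
    using G by (intro graph_connected_iff) (auto simp: simple_graph_def)
  have edge: "(\<exists>u\<in>A. \<exists>v\<in>V - A. {u, v} \<in> E - F) \<longleftrightarrow> \<not> cut E A \<subseteq> F" for A F
  proof
    show "\<exists>u\<in>A. \<exists>v\<in>V - A. {u, v} \<in> E - F \<Longrightarrow> \<not> cut E A \<subseteq> F"
      unfolding cut_def by blast
    assume "\<not> cut E A \<subseteq> F"
    then obtain e where e: "e \<in> E" "e \<notin> F" "e \<inter> A \<noteq> {}" "\<not> e \<subseteq> A"
      unfolding cut_def by blast
    then obtain p q where pq: "e = {p, q}" "p \<in> V" "q \<in> V"
      using simple_graph_edgeE[OF G] by metis
    have qp: "{q, p} = e" using pq by auto
    consider "p \<in> A" "q \<in> V - A" | "q \<in> A" "p \<in> V - A"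
      using e(3,4) pq by auto
    then show "\<exists>u\<in>A. \<exists>v\<in>V - A. {u, v} \<in> E - F"
    proof cases
      case 1
      have "{p, q} \<in> E - F" using e(1,2) pq(1) by simp
      then show ?thesis using 1 by blast
    next
      case 2
      have "{q, p} \<in> E - F" using e(1,2) qp by simp
      then show ?thesis using 2 by blast
    qed
  qed
  have fin: "finite F" if "F \<subseteq> E" for F
    using finite_subset[OF that simple_graph_finite_edges[OF G]] .
  show ?thesis
  proof (intro iffI conjI allI impI)
    assume k: "k_edge_connected k V E"
    then show "V \<noteq> {}"
      using \<open>k > 0\<close> unfolding k_edge_connected_def graph_connected_def
      by (metis card.empty empty_subsetI)
    fix A
    assume "A \<subseteq> V \<and> A \<noteq> {} \<and> A \<noteq> V"
    moreover have "cut E A \<subseteq> E" unfolding cut_def by blast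
    ultimately show "k \<le> card (cut E A)"
      using k unfolding k_edge_connected_def con edge by (meson not_less order_refl)
  next
    assume R: "V \<noteq> {} \<and> (\<forall>A. A \<subseteq> V \<and> A \<noteq> {} \<and> A \<noteq> V \<longrightarrow> k \<le> card (cut E A))"
    show "k_edge_connected k V E"
      unfolding k_edge_connected_def con edge
    proof (intro allI impI conjI)
      show "V \<noteq> {}" using R by blast
      fix F A
      assume F: "F \<subseteq> E \<and> card F < k" and A: "A \<subseteq> V \<and> A \<noteq> {} \<and> A \<noteq> V"
      have "k \<le> card (cut E A)" using R A by blast
      moreover have "card (cut E A) \<le> card F" if "cut E A \<subseteq> F"
        using card_mono[OF _ that] fin F by blast
      ultimately show "\<not> cut E A \<subseteq> F" using F by linarith
    qed
  qed
qed

lemma card_cut_eq_sum: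
  "finite E \<Longrightarrow> card (cut E A) = (\<Sum>e\<in>E. of_bool (e \<inter> A \<noteq> {} \<and> \<not> e \<subseteq> A))"
  unfolding cut_def by (simp add: Collect_conj_eq Int_commute)

lemma cut_submodular:
  assumes G: "simple_graph V E"
  shows "card (cut E (A \<inter> B)) + card (cut E (A \<union> B)) \<le> card (cut E A) + card (cut E B)"
proof -
  have fin: "finite E" using simple_graph_finite_edges[OF G] .
  show ?thesis
    unfolding card_cut_eq_sum[OF fin] sum.distrib[symmetric]
  proof (rule sum_mono)
    fix e
    assume "e \<in> E"
    then obtain u v where "e = {u, v}"
      using simple_graph_edgeE[OF G] by metis
    then show "of_bool (e \<inter> (A \<inter> B) \<noteq> {} \<and> \<not> e \<subseteq> A \<inter> B) +
        of_bool (e \<inter> (A \<union> B) \<noteq> {} \<and> \<not> e \<subseteq> A \<union> B)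
      \<le> of_bool (e \<inter> A \<noteq> {} \<and> \<not> e \<subseteq> A) + (of_bool (e \<inter> B \<noteq> {} \<and> \<not> e \<subseteq> B) :: nat)"
      by auto
  qed
qed

lemma cut_posimodular:
  assumes G: "simple_graph V E"
  shows "card (cut E (A - B)) + card (cut E (B - A)) \<le> card (cut E A) + card (cut E B)"
proof -
  have fin: "finite E" using simple_graph_finite_edges[OF G] .
  show ?thesis
    unfolding card_cut_eq_sum[OF fin] sum.distrib[symmetric]
  proof (rule sum_mono)
    fix e
    assume "e \<in> E"
    then obtain u v where "e = {u, v}"
      using simple_graph_edgeE[OF G] by metis
    then show "of_bool (e \<inter> (A - B) \<noteq> {} \<and> \<not> e \<subseteq> A - B) +
        of_bool (e \<inter> (B - A) \<noteq> {} \<and> \<not> e \<subseteq> B - A)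
      \<le> of_bool (e \<inter> A \<noteq> {} \<and> \<not> e \<subseteq> A) + (of_bool (e \<inter> B \<noteq> {} \<and> \<not> e \<subseteq> B) :: nat)"
      by auto
  qed
qed

text \<open>Outside the two degenerate positions, the four sets \<open>Z \<inter> W\<close>, \<open>Z \<union> W\<close>, \<open>Z - W\<close> and \<open>W - Z\<close>
  are all nonempty and proper, so each of them has at least \<open>c\<close> leaving edges, while
  submodularity and posimodularity bound the sums over the two pairs by \<open>2 * c\<close>.\<close>

lemma minimum_cuts_uncross:
  assumes G: "simple_graph V E"
    and con: "\<And>A. A \<subseteq> V \<Longrightarrow> A \<noteq> {} \<Longrightarrow> A \<noteq> V \<Longrightarrow> c \<le> card (cut E A)"
    and Z: "Z \<subseteq> V" "card (cut E Z) = c" and W: "W \<subseteq> V" "card (cut E W) = c"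
    and split: "Z \<inter> W \<noteq> {}" "Z - W \<noteq> {}"
  shows "W \<subseteq> Z \<or> V - W \<subseteq> Z \<or>
    card (cut E (Z \<inter> W)) = c \<and> card (cut E (Z - W)) = c"
proof (cases "W \<subseteq> Z \<or> V - W \<subseteq> Z")
  case True
  then show ?thesis by blast
next
  case False
  have "c \<le> card (cut E (Z \<inter> W))" "c \<le> card (cut E (Z \<union> W))"
    "c \<le> card (cut E (Z - W))" "c \<le> card (cut E (W - Z))"
    using False split Z(1) W(1) by (intro con; blast)+
  then show ?thesis
    using cut_submodular[OF G, of Z W] cut_posimodular[OF G, of Z W] Z(2) W(2) by linarith
qed

text \<open>Only a cut of size \<open>k\<close> through \<open>e\<close> could become too small. It would separate the ends of
  \<open>e\<close> and hence split \<open>Z\<close>, and uncrossing would give a smaller set in place of \<open>Z\<close>.\<close>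

lemma delete_edge_inside_minimal_cut:
  assumes G: "simple_graph V E"
    and con: "\<And>A. A \<subseteq> V \<Longrightarrow> A \<noteq> {} \<Longrightarrow> A \<noteq> V \<Longrightarrow> k \<le> card (cut E A)"
    and Z: "Z \<subseteq> V" "Z \<noteq> V" "card (cut E Z) = k"
    and min: "\<And>B. B \<subset> Z \<Longrightarrow> B \<noteq> {} \<Longrightarrow> card (cut E B) \<noteq> k"
    and e: "e \<subseteq> Z" and A: "A \<subseteq> V" "A \<noteq> {}" "A \<noteq> V"
  shows "k \<le> card (cut (E - {e}) A)"
proof (cases "e \<in> cut E A \<and> card (cut E A) = k")
  case True
  have s: "Z \<inter> A \<noteq> {}" "Z - A \<noteq> {}"
    using True e unfolding cut_def by auto
  have "A \<subseteq> Z \<or> V - A \<subseteq> Z \<or> card (cut E (Z \<inter> A)) = k \<and> card (cut E (Z - A)) = k"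
    using minimum_cuts_uncross[OF G con Z(1,3) A(1) _ s] True by blast
  moreover have "card (cut E (V - A)) = k"
    using True cut_complement[OF G A(1)] by simp
  ultimately show ?thesis
    using min[of A] min[of "V - A"] min[of "Z \<inter> A"] s A True by blast
next
  case False
  have "card (cut E A) \<ge> k" using con A by blast
  then show ?thesis
    using False finite_cut[OF simple_graph_finite_edges[OF G], of A]
    by (cases "e \<in> cut E A") (auto simp: cut_delete)
qed

text \<open>If two vertices of \<open>Z\<close> have no edge inside \<open>Z\<close> except possibly the one joining them, then
  at least \<open>k\<close> edges at each of them leave \<open>Z\<close>. A cut of fewer than \<open>2 * k\<close> edges
  therefore has a further edge inside \<open>Z\<close>, and this edge brings a third vertex along.\<close>

lemma edge_inside_small_cut:
  assumes G: "simple_graph V E" and Z: "Z \<subseteq> V" "card Z \<ge> 2"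
    and deg: "\<And>v. v \<in> V \<Longrightarrow> vertex_degree E v \<ge> k + 1"
    and small: "card (cut E Z) < 2 * k"
  shows "card Z \<ge> 3" "\<exists>e\<in>E. e \<subseteq> Z"
proof -
  have finE: "finite E" using simple_graph_finite_edges[OF G] .
  have finZ: "finite Z" using Z G unfolding simple_graph_def by (metis finite_subset)
  obtain u v where uv: "u \<in> Z" "v \<in> Z" "u \<noteq> v"
    using Z(2) card_le_Suc0_iff_eq[OF finZ] by fastforce
  have "\<exists>e\<in>E. e \<subseteq> Z \<and> e \<noteq> {u, v}"
  proof (rule ccontr)
    assume no: "\<not> ?thesis"
    let ?D = "\<lambda>w. {e \<in> E. w \<in> e} - {{u, v}}"
    have D: "k \<le> card (?D w)" if "w \<in> Z" for w
    proof -
      have "k + 1 \<le> card {e \<in> E. w \<in> e}"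
        using deg Z(1) that unfolding vertex_degree_def by blast
      then show ?thesis
        using diff_card_le_card_Diff[of "{{u, v}}" "{e \<in> E. w \<in> e}"] by simp
    qed
    have "e = {u, v}" if "e \<in> E" "u \<in> e" "v \<in> e" for e
      using simple_graph_edgeE[OF G that(1)] that uv(3) by (metis empty_iff insert_commute insert_iff)
    then have "?D u \<inter> ?D v = {}" by blast
    then have "card (?D u) + card (?D v) = card (?D u \<union> ?D v)"
      using finE by (intro card_Un_disjoint[symmetric]) auto
    also have "\<dots> \<le> card (cut E Z)"
      using no uv by (intro card_mono finite_cut[OF finE]) (auto simp: cut_def)
    finally show False
      using D[OF uv(1)] D[OF uv(2)] small by linarith
  qed
  then obtain e where e: "e \<in> E" "e \<subseteq> Z" "e \<noteq> {u, v}" by blast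
  then show "\<exists>e\<in>E. e \<subseteq> Z" by blast
  obtain p q where pq: "e = {p, q}" "p \<noteq> q"
    using simple_graph_edgeE[OF G e(1)] by metis
  then obtain w where "w \<in> Z" "w \<noteq> u" "w \<noteq> v"
    using e by (metis doubleton_eq_iff insert_subset)
  then have "card {u, v, w} \<le> card Z"
    using uv by (intro card_mono finZ) auto
  then show "card Z \<ge> 3"
    using uv \<open>w \<noteq> u\<close> \<open>w \<noteq> v\<close> by (simp add: card_insert_if)
qed

lemma obtain_minimal_subset:
  assumes "finite X" "P X"
  obtains Z where "Z \<subseteq> X" "P Z" "\<And>B. B \<subset> Z \<Longrightarrow> \<not> P B"
proof -
  have "finite {Z. Z \<subseteq> X \<and> P Z}" "X \<in> {Z. Z \<subseteq> X \<and> P Z}"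
    using assms by auto
  then obtain Z where Z: "Z \<in> {Z. Z \<subseteq> X \<and> P Z}"
    "\<forall>B\<in>{Z. Z \<subseteq> X \<and> P Z}. B \<subseteq> Z \<longrightarrow> Z = B"
    using finite_has_minimal2[of "{Z. Z \<subseteq> X \<and> P Z}" X] by metis
  show thesis
    using Z by (intro that[of Z]) auto
qed

theorem edge_connected_delete_matching:
  assumes "k \<ge> 2" and G: "simple_graph V E"
    and deg: "\<And>v. v \<in> V \<Longrightarrow> vertex_degree E v \<ge> k + 1"
    and kc: "k_edge_connected k V E"
  obtains e f where "e \<in> E" "f \<in> E" "e \<inter> f = {}" "k_edge_connected k V (E - {e, f})"
proof -
  have finV: "finite V" using G unfolding simple_graph_def by blast
  have finE: "finite E" using simple_graph_finite_edges[OF G] .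
  have k0: "k > 0" using assms(1) by linarith
  have "V \<noteq> {}" and con: "\<And>A. A \<subseteq> V \<Longrightarrow> A \<noteq> {} \<Longrightarrow> A \<noteq> V \<Longrightarrow> k \<le> card (cut E A)"
    using kc k_edge_connected_iff_cut[OF G k0] by auto
  have goal: "k_edge_connected k V (E - {e, f})"
    if "\<And>A. A \<subseteq> V \<Longrightarrow> A \<noteq> {} \<Longrightarrow> A \<noteq> V \<Longrightarrow> k \<le> card (cut (E - {e, f}) A)" for e f
    using k_edge_connected_iff_cut[OF simple_graph_subset[OF G] k0] \<open>V \<noteq> {}\<close> that by blast
  have disj: "\<exists>f\<in>E. e \<inter> f = {}" if eE: "e \<in> E" for e
  proof -
    obtain x y where xy: "e = {x, y}" "x \<noteq> y" "x \<in> V" "y \<in> V"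
      using simple_graph_edgeE[OF G eE] .
    have deg3: "\<And>v. v \<in> V \<Longrightarrow> vertex_degree E v \<ge> 3"
      using deg assms(1) by fastforce
    obtain v where v: "v \<in> V" "v \<noteq> x" "v \<noteq> y"
      using exists_neighbour_outside[OF G, of "{y}" x] deg3[OF xy(3)] by auto
    obtain u where "{v, u} \<in> E" "u \<noteq> x" "u \<noteq> y"
      using exists_disjoint_edge[OF G v deg3] by blast
    then show ?thesis
      using v xy(1) by (intro bexI[of _ "{v, u}"]) auto
  qed
  show thesis
  proof (cases "\<exists>A. A \<subseteq> V \<and> A \<noteq> {} \<and> A \<noteq> V \<and> card (cut E A) = k")
    case True
    let ?P = "\<lambda>A. A \<noteq> {} \<and> card (cut E A) = k"
    obtain A where A: "A \<subseteq> V" "A \<noteq> {}" "A \<noteq> V" "card (cut E A) = k"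
      using True by blast
    have inside: "\<exists>e\<in>E. e \<subseteq> Z" if "Z \<subseteq> V" "Z \<noteq> {}" "card (cut E Z) = k" for Z
    proof -
      have finZ: "finite Z" using that finV finite_subset by blast
      have "card Z \<noteq> 1"
      proof
        assume "card Z = 1"
        then obtain v where v: "Z = {v}" using card_1_singletonE by blast
        have "\<not> e \<subseteq> {v}" if "e \<in> E" for e
          using simple_graph_edgeE[OF G that] by (metis insert_subset singletonD)
        then have "{e \<in> E. v \<in> e} = cut E Z"
          unfolding v cut_def by blast
        then show False
          using deg[of v] that v unfolding vertex_degree_def by simp
      qed
      moreover have "card Z \<noteq> 0" using that finZ by simp
      ultimately have "card Z \<ge> 2" by linarith
      then show ?thesis
        using edge_inside_small_cut(2)[OF G that(1) _ deg] that(3) k0 by simp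
    qed
    obtain Z where Z: "Z \<subseteq> A" "?P Z" "\<And>B. B \<subset> Z \<Longrightarrow> \<not> ?P B"
      using obtain_minimal_subset[of A ?P] A finV finite_subset by blast
    have ZV: "Z \<subseteq> V" "Z \<noteq> V" using Z A by auto
    have "?P (V - Z)"
      using cut_complement[OF G ZV(1)] Z(2) ZV by auto
    then obtain Y where Y: "Y \<subseteq> V - Z" "?P Y" "\<And>B. B \<subset> Y \<Longrightarrow> \<not> ?P B"
      using obtain_minimal_subset[of "V - Z" ?P] finV by blast
    have YV: "Y \<subseteq> V" "Y \<noteq> V" using Y Z ZV by auto
    obtain e where e: "e \<in> E" "e \<subseteq> Z" using inside[OF ZV(1)] Z(2) by blast
    obtain f where f: "f \<in> E" "f \<subseteq> Y" using inside[OF YV(1)] Y(2) by blast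
    have con': "k \<le> card (cut (E - {e}) A)" if "A \<subseteq> V" "A \<noteq> {}" "A \<noteq> V" for A
      using delete_edge_inside_minimal_cut[OF G con ZV] Z e that by blast
    \<comment> \<open>No end of \<open>e\<close> lies in \<open>Y\<close>, so deleting \<open>e\<close> keeps \<open>Y\<close> minimal.\<close>
    have same: "cut (E - {e}) B = cut E B" if "B \<subseteq> Y" for B
      using that e Y(1) unfolding cut_def by blast
    have "k \<le> card (cut (E - {e} - {f}) A)" if "A \<subseteq> V" "A \<noteq> {}" "A \<noteq> V" for A
    proof (rule delete_edge_inside_minimal_cut[OF _ con' YV])
      show "simple_graph V (E - {e})" using simple_graph_subset[OF G] by blast
      show "card (cut (E - {e}) Y) = k" using same Y(2) by simp
      show "card (cut (E - {e}) B) \<noteq> k" if "B \<subset> Y" "B \<noteq> {}" for B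
        using same[of B] Y(3)[of B] that by auto
    qed (use f that in auto)
    moreover have "E - {e} - {f} = E - {e, f}" by blast
    ultimately have "k_edge_connected k V (E - {e, f})"
      using goal by simp
    moreover have "e \<inter> f = {}" using e f Y(1) by blast
    ultimately show thesis using that e f by blast
  next
    case False
    have con1: "k + 1 \<le> card (cut E A)" if "A \<subseteq> V" "A \<noteq> {}" "A \<noteq> V" for A
      using con[OF that] False that by (metis Suc_eq_plus1 not_less_eq_eq le_antisym)
    \<comment> \<open>Cuts of size \<open>k + 1\<close> around single vertices may contain \<open>e\<close>, so they are left out of the
      minimality argument; both sides of the others have at least two vertices.\<close>
    let ?P = "\<lambda>A. card A \<ge> 2 \<and> card (V - A) \<ge> 2 \<and> card (cut E A) = k + 1"
    have "\<exists>e\<in>E. \<forall>A. A \<subseteq> V \<and> ?P A \<longrightarrow> e \<notin> cut E A"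
    proof (cases "\<exists>A. A \<subseteq> V \<and> ?P A")
      case True
      then obtain A where A: "A \<subseteq> V" "?P A" by blast
      obtain Z where Z: "Z \<subseteq> A" "?P Z" "\<And>B. B \<subset> Z \<Longrightarrow> \<not> ?P B"
        using obtain_minimal_subset[of A ?P] A finV finite_subset by blast
      have ZV: "Z \<subseteq> V" using Z(1) A(1) by blast
      have finZ: "finite Z" using finite_subset[OF ZV finV] .
      have "card (cut E Z) < 2 * k" using Z(2) assms(1) by linarith
      then have Z3: "card Z \<ge> 3" and "\<exists>e\<in>E. e \<subseteq> Z"
        using edge_inside_small_cut[OF G ZV _ deg] Z(2) by blast+
      then obtain e where e: "e \<in> E" "e \<subseteq> Z" by blast
      have "e \<notin> cut E W" if W: "W \<subseteq> V" "?P W" for W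
      proof
        assume "e \<in> cut E W"
        then have s: "Z \<inter> W \<noteq> {}" "Z - W \<noteq> {}"
          using e unfolding cut_def by auto
        have compl: "card (V - B) \<ge> 2" if "B \<subseteq> Z" for B
          using card_mono[of "V - B" "V - Z"] that finV Z(2) by (meson Diff_mono finite_Diff le_trans order_refl)
        have "card (cut E (V - W)) = k + 1" "V - (V - W) = W"
          using W cut_complement[OF G W(1)] by auto
        then have "?P (V - W)" using W by simp
        then have "\<not> W \<subset> Z" "\<not> V - W \<subset> Z" using Z(3) W by blast+
        then have "\<not> W \<subseteq> Z" "\<not> V - W \<subseteq> Z" using s by blast+
        then have t: "card (cut E (Z \<inter> W)) = k + 1" "card (cut E (Z - W)) = k + 1"
          using minimum_cuts_uncross[OF G con1 ZV _ W(1) _ s] Z(2) W(2) by blast+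
        \<comment> \<open>Minimality of \<open>Z\<close> leaves only single vertices for both parts, too few for
          the at least three vertices of \<open>Z\<close>.\<close>
        have sub: "Z \<inter> W \<subset> Z" "Z - W \<subset> Z" using s by blast+
        have "card (Z \<inter> W) < 2"
          using Z(3)[OF sub(1)] t(1) compl[of "Z \<inter> W"] by auto
        moreover have "card (Z - W) < 2"
          using Z(3)[OF sub(2)] t(2) compl[of "Z - W"] by auto
        moreover have "card Z = card (Z \<inter> W) + card (Z - W)"
          using card_Un_disjoint[of "Z \<inter> W" "Z - W"] finZ by (simp add: Int_Diff_Un Int_Diff_disjoint)
        ultimately show False using Z3 by linarith
      qed
      then show ?thesis using e by blast
    next
      case no_nontrivial: False
      obtain v where v: "v \<in> V" using \<open>V \<noteq> {}\<close> by blast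
      have "card {} < vertex_degree E v" using deg[OF v] by simp
      then obtain u where "{v, u} \<in> E"
        using exists_neighbour_outside[OF G finite.emptyI] by blast
      then show ?thesis using no_nontrivial by blast
    qed
    then obtain e where e: "e \<in> E" "\<And>A. A \<subseteq> V \<Longrightarrow> ?P A \<Longrightarrow> e \<notin> cut E A" by blast
    obtain f where f: "f \<in> E" "e \<inter> f = {}" using disj[OF e(1)] by blast
    have not_both_at: "\<not> {e, f} \<subseteq> cut E {v}" for v
      using f(2) unfolding cut_def by blast
    have "k \<le> card (cut (E - {e, f}) A)" if A: "A \<subseteq> V" "A \<noteq> {}" "A \<noteq> V" for A
    proof -
      have fA: "finite A" "finite (V - A)" using finite_subset[OF A(1) finV] finV by auto
      have "k + 2 \<le> card (cut E A) \<or> \<not> {e, f} \<subseteq> cut E A"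
      proof (cases "?P A")
        case True
        then show ?thesis using e A by blast
      next
        case False
        then consider "card (cut E A) \<ge> k + 2" | "card A < 2" | "card (V - A) < 2"
          using con1[OF A] by linarith
        then show ?thesis
        proof cases
          case 2
          then have "card A = 1" using A fA by (metis One_nat_def card_0_eq less_2_cases)
          then obtain v where "A = {v}" using card_1_singletonE by blast
          then show ?thesis using not_both_at[of v] by simp
        next
          case 3
          moreover have "V - A \<noteq> {}" using A by blast
          ultimately have "card (V - A) = 1" using fA by (metis One_nat_def card_0_eq less_2_cases)
          then obtain v where "V - A = {v}" using card_1_singletonE by blast
          then have "cut E A = cut E {v}" using cut_complement[OF G A(1)] by simp
          then show ?thesis using not_both_at[of v] by simp
        qed blast
      qed
      moreover have "card (cut E A) \<le> card (cut E A - {e, f}) + card (cut E A \<inter> {e, f})"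
        using card_Diff_subset_Int[of "cut E A" "{e, f}"] by simp
      moreover have "card (cut E A \<inter> {e, f}) \<le> 2"
        by (rule order_trans[OF card_mono[of "{e, f}"]]) (auto simp: card_insert_if)
      moreover have "card (cut E A \<inter> {e, f}) \<le> 1" if "\<not> {e, f} \<subseteq> cut E A"
      proof -
        have "cut E A \<inter> {e, f} \<subseteq> {e} \<or> cut E A \<inter> {e, f} \<subseteq> {f}" using that by blast
        then show ?thesis
          using card_mono[of "{e}" "cut E A \<inter> {e, f}"] card_mono[of "{f}" "cut E A \<inter> {e, f}"] by auto
      qed
      ultimately show ?thesis
        using con1[OF A] unfolding cut_delete by linarith
    qed
    then have "k_edge_connected k V (E - {e, f})" by (rule goal)
    then show thesis using that e(1) f by blast
  qed
qed

section \<open>Separations at critical edges\<close>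

lemma k_connected_iff_separation:
  assumes G: "simple_graph V E"
  shows "k_connected k V E \<longleftrightarrow> card V \<ge> k + 1 \<and>
    (\<forall>S P. S \<subseteq> V \<and> card S < k \<and> P \<subseteq> V - S \<and> P \<noteq> {} \<and> P \<noteq> V - S \<longrightarrow>
      (\<exists>u\<in>P. \<exists>v\<in>V - S - P. {u, v} \<in> E))"
proof -
  have con: "graph_connected (V - S) {e \<in> E. e \<inter> S = {}} \<longleftrightarrow> V - S \<noteq> {} \<and>
      (\<forall>P. P \<subseteq> V - S \<and> P \<noteq> {} \<and> P \<noteq> V - S \<longrightarrow> (\<exists>u\<in>P. \<exists>v\<in>V - S - P. {u, v} \<in> E))" for S
  proof -
    have *: "graph_connected (V - S) {e \<in> E. e \<inter> S = {}} \<longleftrightarrow> V - S \<noteq> {} \<and>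
      (\<forall>P. P \<subseteq> V - S \<and> P \<noteq> {} \<and> P \<noteq> V - S \<longrightarrow>
        (\<exists>u\<in>P. \<exists>v\<in>V - S - P. {u, v} \<in> {e \<in> E. e \<inter> S = {}}))"
      using G by (intro graph_connected_iff) (auto simp: simple_graph_def)
    show ?thesis
      unfolding * by (intro conj_cong arg_cong[where f = All] ext imp_cong refl bex_cong) auto
  qed
  have "V - S \<noteq> {}" if "card V \<ge> k + 1" "S \<subseteq> V" "card S < k" for S
    using that by (metis Diff_eq_empty_iff Suc_eq_plus1 not_less_eq_eq order_less_imp_le subset_antisym)
  then show ?thesis
    unfolding k_connected_def con by (intro iffI conjI allI impI; blast)
qed

text \<open>The witness that deleting the edge \<open>ab\<close> destroys \<open>k\<close>-connectivity. Bounding \<open>card T\<close> by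
  \<open>card T < k\<close>, and not fixing it to \<open>k - 1\<close>, lets any separating set of the graph without \<open>ab\<close>
  serve as \<open>T\<close> unchanged.\<close>

definition critical_separation ::
  "nat \<Rightarrow> 'a set \<Rightarrow> 'a set set \<Rightarrow> 'a \<Rightarrow> 'a \<Rightarrow> 'a set \<Rightarrow> 'a set \<Rightarrow> 'a set \<Rightarrow> bool" where
  "critical_separation k V E a b L T R \<longleftrightarrow>
     L \<union> T \<union> R = V \<and> L \<inter> T = {} \<and> L \<inter> R = {} \<and> T \<inter> R = {} \<and> card T < k \<and>
     a \<in> L \<and> b \<in> R \<and> {a, b} \<in> E \<and>
     (\<forall>u\<in>L. \<forall>v\<in>R. {u, v} \<in> E \<longrightarrow> u = a \<and> v = b)"

lemma critical_separation_exists: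
  assumes G: "simple_graph V E" and kc: "k_connected k V E" and ab: "{a, b} \<in> E"
    and crit: "\<not> k_connected k V (E - {{a, b}})"
  shows "\<exists>L T R. critical_separation k V E a b L T R"
proof -
  have G': "simple_graph V (E - {{a, b}})"
    using simple_graph_subset[OF G] by blast
  have "card V \<ge> k + 1"
    using kc unfolding k_connected_def by blast
  then have "\<exists>S P. (S \<subseteq> V \<and> card S < k \<and> P \<subseteq> V - S \<and> P \<noteq> {} \<and> P \<noteq> V - S) \<and>
      \<not> (\<exists>u\<in>P. \<exists>v\<in>V - S - P. {u, v} \<in> E - {{a, b}})"
    using crit unfolding k_connected_iff_separation[OF G'] by (simp only: simp_thms not_all not_imp)
  then obtain S P where S: "S \<subseteq> V" "card S < k" and P: "P \<subseteq> V - S" "P \<noteq> {}" "P \<noteq> V - S"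
    and no: "\<not> (\<exists>u\<in>P. \<exists>v\<in>V - S - P. {u, v} \<in> E - {{a, b}})"
    by (elim exE conjE) (rule that)
  have only: "{p, q} = {a, b}" if "p \<in> P" "q \<in> V - S - P" "{p, q} \<in> E" for p q
    using no that by (metis DiffI singletonD)
  obtain u v where uv: "u \<in> P" "v \<in> V - S - P" "{u, v} \<in> E"
    using kc S P unfolding k_connected_iff_separation[OF G] by blast
  then have "{u, v} = {a, b}" using only by blast
  then have unique: "p = u \<and> q = v" if "p \<in> P" "q \<in> V - S - P" "{p, q} \<in> E" for p q
    using only[OF that] that uv by (metis DiffD2 doubleton_eq_iff)
  consider "a = u" "b = v" | "a = v" "b = u"
    using \<open>{u, v} = {a, b}\<close> by (auto simp: doubleton_eq_iff)
  then show ?thesis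
  proof cases
    case 1
    have "critical_separation k V E a b P S (V - S - P)"
      unfolding critical_separation_def 1 using S P uv unique by (intro conjI ballI impI) blast+
    then show ?thesis by blast
  next
    case 2
    have "p = v \<and> q = u" if "p \<in> V - S - P" "q \<in> P" "{p, q} \<in> E" for p q
      using unique[of q p] that by (simp add: insert_commute)
    moreover have "{v, u} \<in> E" using uv(3) by (simp add: insert_commute)
    ultimately have "critical_separation k V E a b (V - S - P) S P"
      unfolding critical_separation_def 2 using S P uv(1,2) by (intro conjI ballI impI) blast+
    then show ?thesis by blast
  qed
qed

text \<open>The two separations divide \<open>V\<close> into nine parts. The corner \<open>A \<inter> B\<close> contains \<open>b\<close>, and apart
  from the edges \<open>ba\<close> and \<open>bc\<close> it is cut off by the set \<open>Q1\<close> below; the opposite corner \<open>X \<inter> Y\<close>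
  is cut off by \<open>Q2\<close>, and \<open>card Q1 + card Q2 = card S + card T \<le> 2 * (k - 1)\<close>. Since \<open>b\<close> has
  degree greater than \<open>k\<close>, a set \<open>Q1\<close> of size at most \<open>k - 2\<close> would leave a further vertex in
  \<open>A \<inter> B\<close>, separated from \<open>a\<close> by \<open>Q1\<close> and \<open>b\<close>. So \<open>card Q1 \<ge> k - 1\<close>, which makes \<open>Q2\<close> too small to
  cut off a nonempty corner, and all the comparisons follow by counting.\<close>

lemma critical_separations_cross:
  assumes G: "simple_graph V E" and kc: "k_connected k V E"
    and deg: "vertex_degree E b \<ge> k + 1"
    and XSA: "critical_separation k V E a b X S A"
    and BTY: "critical_separation k V E b c B T Y"
    and "a \<noteq> c"
  shows "X \<inter> Y = {}" "card (X \<inter> T) \<le> card (S \<inter> B)" "card (S \<inter> Y) \<le> card (A \<inter> T)"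
    "card Y < card A"
proof -
  have finV: "finite V" using G unfolding simple_graph_def by blast
  have V1: "X \<union> S \<union> A = V" "X \<inter> S = {}" "X \<inter> A = {}" "S \<inter> A = {}" "card S < k"
      "a \<in> X" "b \<in> A" "{a, b} \<in> E"
    and no1: "\<And>u v. u \<in> X \<Longrightarrow> v \<in> A \<Longrightarrow> {u, v} \<in> E \<Longrightarrow> u = a \<and> v = b"
    using XSA unfolding critical_separation_def by auto
  have V2: "B \<union> T \<union> Y = V" "B \<inter> T = {}" "B \<inter> Y = {}" "T \<inter> Y = {}" "card T < k"
      "b \<in> B" "c \<in> Y" "{b, c} \<in> E"
    and no2: "\<And>u v. u \<in> B \<Longrightarrow> v \<in> Y \<Longrightarrow> {u, v} \<in> E \<Longrightarrow> u = b \<and> v = c"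
    using BTY unfolding critical_separation_def by auto
  have fin: "finite X" "finite S" "finite A" "finite B" "finite T" "finite Y"
    using finV V1(1) V2(1) by (metis finite_Un)+
  have sep: "k \<le> card Q" if "Q \<subseteq> V" "P \<subseteq> V - Q" "P \<noteq> {}" "z \<in> V - Q - P"
    and "\<And>u v. u \<in> P \<Longrightarrow> v \<in> V - Q - P \<Longrightarrow> {u, v} \<notin> E" for P Q z
    using kc that unfolding k_connected_iff_separation[OF G] by (metis Diff_iff not_le)
  have aY: "a \<notin> Y" using no2[of b a] V1 V2 \<open>a \<noteq> c\<close> by (auto simp: insert_commute)
  have cX: "c \<notin> X" using no1[of c b] V1 V2 \<open>a \<noteq> c\<close> by (auto simp: insert_commute)
  define Q1 where "Q1 = (A \<inter> T) \<union> (S \<inter> T) \<union> (S \<inter> B)"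
  define Q2 where "Q2 = (X \<inter> T) \<union> (S \<inter> T) \<union> (S \<inter> Y)"
  have finQ: "finite Q1" "finite Q2" unfolding Q1_def Q2_def using fin by auto
  have cQ1: "card Q1 = card (A \<inter> T) + card (S \<inter> T) + card (S \<inter> B)"
    unfolding Q1_def using fin V1 V2 by (subst card_Un_disjoint; (subst card_Un_disjoint)?; auto)
  have cQ2: "card Q2 = card (X \<inter> T) + card (S \<inter> T) + card (S \<inter> Y)"
    unfolding Q2_def using fin V1 V2 by (subst card_Un_disjoint; (subst card_Un_disjoint)?; auto)
  have "S = (S \<inter> B) \<union> (S \<inter> T) \<union> (S \<inter> Y)" using V1 V2 by blast
  moreover have "card ((S \<inter> B) \<union> (S \<inter> T) \<union> (S \<inter> Y)) = card (S \<inter> B) + card (S \<inter> T) + card (S \<inter> Y)"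
    using fin V2 by (subst card_Un_disjoint; (subst card_Un_disjoint)?; auto)
  ultimately have cS: "card S = card (S \<inter> B) + card (S \<inter> T) + card (S \<inter> Y)" by metis
  have "T = (A \<inter> T) \<union> (S \<inter> T) \<union> (X \<inter> T)" using V1 V2 by blast
  moreover have "card ((A \<inter> T) \<union> (S \<inter> T) \<union> (X \<inter> T)) = card (A \<inter> T) + card (S \<inter> T) + card (X \<inter> T)"
    using fin V1 by (subst card_Un_disjoint; (subst card_Un_disjoint)?; auto)
  ultimately have cT: "card T = card (A \<inter> T) + card (S \<inter> T) + card (X \<inter> T)" by metis
  have Q1: "k \<le> card Q1 + 1"
  proof (rule ccontr)
    assume small: "\<not> ?thesis"
    have "card (insert a (insert c Q1)) < vertex_degree E b"
      using small deg finQ by (simp add: card_insert_if)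
    then obtain u where u: "{b, u} \<in> E" "u \<notin> insert a (insert c Q1)" "u \<noteq> b" "u \<in> V"
      using exists_neighbour_outside[OF G] finQ by (metis finite_insert)
    have "u \<notin> X" using no1[of u b] u V1 by (auto simp: insert_commute)
    moreover have "u \<notin> Y" using no2[of b u] u V2 by auto
    ultimately have uP: "u \<in> A \<inter> B - {b}" using u V1(1) V2(1) unfolding Q1_def by blast
    have "k \<le> card (insert b Q1)"
    proof (rule sep)
      show "insert b Q1 \<subseteq> V" "A \<inter> B - {b} \<subseteq> V - insert b Q1"
        unfolding Q1_def using V1 V2 by auto
      show "A \<inter> B - {b} \<noteq> {}" using uP by blast
      show "a \<in> V - insert b Q1 - (A \<inter> B - {b})"
        unfolding Q1_def using V1 by blast
      fix p q
      assume p: "p \<in> A \<inter> B - {b}" and q: "q \<in> V - insert b Q1 - (A \<inter> B - {b})"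
      show "{p, q} \<notin> E"
      proof
        assume "{p, q} \<in> E"
        then have "q \<notin> X" "q \<notin> Y"
          using no1[of q p] no2[of p q] p by (auto simp: insert_commute)
        then show False using q V1(1) V2(1) unfolding Q1_def by blast
      qed
    qed
    then show False using small finQ by (simp add: card_insert_if split: if_splits)
  qed
  show XY: "X \<inter> Y = {}"
  proof (rule ccontr)
    assume ne: "X \<inter> Y \<noteq> {}"
    have "k \<le> card Q2"
    proof (rule sep)
      show "Q2 \<subseteq> V" "X \<inter> Y \<subseteq> V - Q2" unfolding Q2_def using V1 V2 by auto
      show "X \<inter> Y \<noteq> {}" by fact
      show "b \<in> V - Q2 - X \<inter> Y" unfolding Q2_def using V1 V2 by blast
      fix p q
      assume p: "p \<in> X \<inter> Y" and q: "q \<in> V - Q2 - X \<inter> Y"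
      show "{p, q} \<notin> E"
      proof
        assume "{p, q} \<in> E"
        then have "q \<notin> A" "q \<notin> B"
          using no1[of p q] no2[of q p] p aY cX by (auto simp: insert_commute)
        then show False using q V1(1) V2(1) unfolding Q2_def by blast
      qed
    qed
    then show False using Q1 cQ1 cQ2 cS cT V1(5) V2(5) by linarith
  qed
  show "card (X \<inter> T) \<le> card (S \<inter> B)" using Q1 cQ1 cT V2(5) by linarith
  show SY: "card (S \<inter> Y) \<le> card (A \<inter> T)" using Q1 cQ1 cS V1(5) by linarith
  have "Y = (S \<inter> Y) \<union> (A \<inter> Y)" using V1(1) V2(1) XY by blast
  moreover have "card ((S \<inter> Y) \<union> (A \<inter> Y)) = card (S \<inter> Y) + card (A \<inter> Y)"
    using fin V1 by (intro card_Un_disjoint) auto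
  ultimately have "card Y = card (S \<inter> Y) + card (A \<inter> Y)" by metis
  moreover have "card (insert b ((A \<inter> T) \<union> (A \<inter> Y))) \<le> card A"
    using V1 fin by (intro card_mono) auto
  moreover have "card (insert b ((A \<inter> T) \<union> (A \<inter> Y))) = Suc (card (A \<inter> T) + card (A \<inter> Y))"
  proof -
    have "b \<notin> (A \<inter> T) \<union> (A \<inter> Y)" using V2 by blast
    moreover have "card ((A \<inter> T) \<union> (A \<inter> Y)) = card (A \<inter> T) + card (A \<inter> Y)"
      using fin V2 by (intro card_Un_disjoint) auto
    ultimately show ?thesis using fin by simp
  qed
  ultimately show "card Y < card A" using SY by linarith
qed

text \<open>If all edges of \<open>H\<close> were critical, an edge \<open>ab\<close> of \<open>H\<close> and a separation for it with the
  side of \<open>b\<close> as small as possible could be beaten by continuing from \<open>b\<close> along another edge of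
  \<open>H\<close>.\<close>

theorem Mader_critical_edges:
  assumes G: "simple_graph V E" and kc: "k_connected k V E"
    and H: "H \<subseteq> E" "H \<noteq> {}"
    and H2: "\<And>v. v \<in> \<Union>H \<Longrightarrow> vertex_degree H v \<ge> 2"
    and deg: "\<And>v. v \<in> \<Union>H \<Longrightarrow> vertex_degree E v \<ge> k + 1"
  obtains e where "e \<in> H" "k_connected k V (E - {e})"
proof (rule ccontr)
  note found = that
  assume "\<not> thesis"
  then have crit: "\<exists>L T R. critical_separation k V E a b L T R" if "{a, b} \<in> H" for a b
    using critical_separation_exists[OF G kc] that H(1) found by blast
  define arc where "arc n \<longleftrightarrow>
    (\<exists>a b L T R. {a, b} \<in> H \<and> critical_separation k V E a b L T R \<and> card R = n)" for n
  have GH: "simple_graph V H" using simple_graph_subset[OF G H(1)] .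
  have "\<exists>n. arc n"
    using H(2) simple_graph_edgeE[OF GH] crit unfolding arc_def by (metis ex_in_conv)
  then obtain n where n: "arc n" "\<And>m. m < n \<Longrightarrow> \<not> arc m"
    using exists_least_iff[of arc] by blast
  then obtain a b X S A where ab: "{a, b} \<in> H" "critical_separation k V E a b X S A" "card A = n"
    unfolding arc_def by blast
  have b: "b \<in> \<Union>H" using ab by blast
  obtain c where c: "{b, c} \<in> H" "c \<noteq> a"
    using exists_neighbour_outside[OF GH, of "{a}" b] H2[OF b] by auto
  obtain B T Y where Y: "critical_separation k V E b c B T Y" using crit[OF c(1)] by blast
  have "card Y < n"
    using critical_separations_cross(4)[OF G kc deg[OF b] ab(2) Y] c(2) ab(3) by blast
  then show False using n(2) c Y unfolding arc_def by blast
qed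

section \<open>Avoiding two vertices\<close>

text \<open>Here \<open>x\<close> and \<open>y\<close> may have degree two, so a walk along critical edges must not enter them.
  The common neighbour \<open>w\<close> makes this possible. In a separation for \<open>wp\<close> the side of \<open>p\<close> contains
  neither \<open>x\<close> nor \<open>y\<close>, because both are adjacent to \<open>w\<close>. Among all critical edges \<open>ab\<close> avoiding
  \<open>x\<close> and \<open>y\<close> and all separations for them with \<open>x\<close> and \<open>y\<close> not on the side of \<open>b\<close>, take one
  with that side smallest. At most one vertex is removed, so \<open>x\<close> or \<open>y\<close> lies on the side of \<open>a\<close> and
  is not adjacent to \<open>b\<close>; hence the walk can be continued from \<open>b\<close> along an edge \<open>bc\<close> that avoids
  both. The new side is smaller, and the common neighbour \<open>w\<close> prevents it from
  containing \<open>x\<close> or \<open>y\<close>.\<close>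

lemma delete_edge_common_neighbour:
  assumes G: "simple_graph V E" and kc: "k_connected 2 V E"
    and deg: "\<And>v. v \<in> V - {x, y} \<Longrightarrow> vertex_degree E v \<ge> 3"
    and xy: "x \<in> V" "y \<in> V" "x \<noteq> y"
    and w: "{w, x} \<in> E" "{w, y} \<in> E" "{w, p} \<in> E" "w \<noteq> x" "w \<noteq> y" "p \<noteq> x" "p \<noteq> y"
  obtains e where "e \<in> E" "e \<inter> {x, y} = {}" "k_connected 2 V (E - {e})"
proof (rule ccontr)
  note found = that
  assume "\<not> thesis"
  then have crit: "\<exists>L T R. critical_separation 2 V E a b L T R"
    if "{a, b} \<in> E" "{a, b} \<inter> {x, y} = {}" for a b
    using critical_separation_exists[OF G kc] that found by blast
  define arc where "arc n \<longleftrightarrow>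
    (\<exists>a b L T R. {a, b} \<inter> {x, y} = {} \<and> critical_separation 2 V E a b L T R
      \<and> x \<notin> R \<and> y \<notin> R \<and> card R = n)" for n
  have finV: "finite V" using G unfolding simple_graph_def by blast
  obtain L T R where LTR: "critical_separation 2 V E w p L T R" using crit[OF w(3)] w by blast
  then have "x \<notin> R" "y \<notin> R"
    using w(1,2,6,7) unfolding critical_separation_def by blast+
  then have "arc (card R)" using LTR w unfolding arc_def by blast
  then obtain n where n: "arc n" "\<And>m. m < n \<Longrightarrow> \<not> arc m"
    using exists_least_iff[of arc] by blast
  then obtain a b X S A where ab: "{a, b} \<inter> {x, y} = {}" "critical_separation 2 V E a b X S A"
      "x \<notin> A" "y \<notin> A" "card A = n"
    unfolding arc_def by blast
  have V1: "X \<union> S \<union> A = V" "X \<inter> A = {}" "card S \<le> 1" "b \<in> A" "{a, b} \<in> E"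
    and no1: "\<And>u v. u \<in> X \<Longrightarrow> v \<in> A \<Longrightarrow> {u, v} \<in> E \<Longrightarrow> u = a \<and> v = b"
    using ab(2) unfolding critical_separation_def by auto
  have finS: "finite S" "finite A" using V1(1) finV by auto
  have S1: "s = t" if "s \<in> S" "t \<in> S" for s t
    using V1(3) card_le_Suc0_iff_eq[OF finS(1)] that by simp
  have bV: "b \<in> V - {x, y}" using ab V1 by blast
  obtain z z' where zz: "z = x \<and> z' = y \<or> z = y \<and> z' = x" and z: "z \<in> X"
    using S1[of x y] xy ab(3,4) V1(1) by blast
  have bz: "{b, z} \<notin> E" using no1[of z b] z zz ab(1) V1 by (auto simp: insert_commute)
  obtain c where c: "{b, c} \<in> E" "c \<noteq> a" "c \<notin> {x, y}"
  proof -
    have "card {a, z'} < vertex_degree E b"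
      using deg[OF bV] by (simp add: card_insert_if)
    then obtain c where "{b, c} \<in> E" "c \<notin> {a, z'}"
      using exists_neighbour_outside[OF G, of "{a, z'}" b] by blast
    then show thesis using that bz zz by blast
  qed
  obtain B T Y where Y: "critical_separation 2 V E b c B T Y" using crit[OF c(1)] c bV by blast
  have cross: "X \<inter> Y = {}" "card (X \<inter> T) \<le> card (S \<inter> B)" "card (S \<inter> Y) \<le> card (A \<inter> T)"
      "card Y < card A"
    using critical_separations_cross[OF G kc _ ab(2) Y] deg[OF bV] c(2) by auto
  have V2: "B \<union> T \<union> Y = V" "B \<inter> Y = {}" "card T \<le> 1"
    and no2: "\<And>u v. u \<in> B \<Longrightarrow> v \<in> Y \<Longrightarrow> {u, v} \<in> E \<Longrightarrow> u = b \<and> v = c"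
    using Y unfolding critical_separation_def by auto
  have finT: "finite T" using V2(1) finV by auto
  have T1: "s = t" if "s \<in> T" "t \<in> T" for s t
    using V2(3) card_le_Suc0_iff_eq[OF finT] that by simp
  \<comment> \<open>By minimality one of \<open>x\<close> and \<open>y\<close>, called \<open>s\<close>, is in the new side \<open>Y\<close>. Then \<open>s\<close> is the vertex
    removed at \<open>ab\<close>, and the other one, \<open>s'\<close>, lies in \<open>X \<inter> B\<close>. As a neighbour of both, \<open>w\<close> can only
    be the vertex removed at \<open>bc\<close>; but that vertex is in \<open>A\<close>, which has no edge to \<open>s'\<close>.\<close>
  have "\<not> (x \<notin> Y \<and> y \<notin> Y)"
    using n(2)[of "card Y"] cross(4) ab(5) Y c bV unfolding arc_def by blast
  then obtain s s' where s': "s = x \<and> s' = y \<or> s = y \<and> s' = x" and s: "s \<in> Y" by blast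
  have sxy: "s \<in> V" "s' \<in> V" "s' \<noteq> s" "s \<notin> A" "s' \<notin> A" "s \<notin> {b, c}" "s' \<notin> {a, b, c}"
    and ws: "{w, s} \<in> E" "{w, s'} \<in> E"
    using s' xy ab(1,3,4) c(3) bV w(1,2) by auto
  have "s \<notin> X" using s cross(1) by blast
  then have sS: "s \<in> S" using V1(1) sxy by blast
  have "S \<inter> B = {}" using S1 sS s V2(2) by blast
  then have "X \<inter> T = {}" using cross(2) finT by simp
  then have XB: "X \<subseteq> B" using cross(1) V1(1) V2(1) by blast
  have "s' \<in> X" using S1 sS sxy V1(1) by blast
  have "card (S \<inter> Y) > 0" using sS s finS by (auto simp: card_gt_0_iff)
  then have "A \<inter> T \<noteq> {}" using cross(3) by force
  then have TA: "T \<subseteq> A" using T1 by blast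
  have "w \<notin> B" using no2[of w s] ws s sxy by blast
  moreover have "w \<notin> Y" using no2[of s' w] ws \<open>s' \<in> X\<close> XB sxy by (auto simp: insert_commute)
  ultimately have "w \<in> A" using TA V2(1) simple_graph_edgeD[OF G ws(1)] by blast
  then show False using no1[of s' w] \<open>s' \<in> X\<close> ws sxy by (auto simp: insert_commute)
qed

theorem delete_edge_avoiding_two_vertices:
  assumes "k \<ge> 2" and G: "simple_graph V E" and kc: "k_connected k V E"
    and deg: "\<And>v. v \<in> V - {x, y} \<Longrightarrow> vertex_degree E v \<ge> k + 1"
    and xy: "x \<in> V" "y \<in> V" "x \<noteq> y"
  obtains e where "e \<in> E" "e \<inter> {x, y} = {}" "k_connected k V (E - {e})"
proof -
  define H where "H = {e \<in> E. e \<inter> {x, y} = {}}"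
  have HE: "H \<subseteq> E" unfolding H_def by blast
  have GH: "simple_graph V H" using simple_graph_subset[OF G HE] .
  have deg3: "\<And>v. v \<in> V - {x, y} \<Longrightarrow> vertex_degree E v \<ge> 3"
    using deg assms(1) by fastforce
  have HV: "\<Union>H \<subseteq> V - {x, y}" using G unfolding H_def simple_graph_def by blast
  show thesis
  proof (cases "\<forall>v\<in>\<Union>H. vertex_degree H v \<ge> 2")
    case True
    have "H \<noteq> {}"
    proof -
      have "card {x, y} < card V" using kc assms(1) xy unfolding k_connected_def by simp
      then have "\<not> V \<subseteq> {x, y}" using card_mono[of "{x, y}" V] by fastforce
      then obtain v where v: "v \<in> V" "v \<noteq> x" "v \<noteq> y" by blast
      obtain u where "{v, u} \<in> E" "u \<noteq> x" "u \<noteq> y"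
        using exists_disjoint_edge[OF G v deg3] .
      then show ?thesis using v unfolding H_def by blast
    qed
    moreover have "vertex_degree E v \<ge> k + 1" if "v \<in> \<Union>H" for v
      using deg[of v] HV that by blast
    ultimately obtain e where "e \<in> H" "k_connected k V (E - {e})"
      using Mader_critical_edges[OF G kc HE] True by metis
    then show thesis using that unfolding H_def by blast
  next
    case False
    then obtain w where w: "w \<in> \<Union>H" "vertex_degree H w < 2" by force
    have wV: "w \<in> V - {x, y}" using w HV by blast
    obtain e where e: "e \<in> H" "w \<in> e" using w by blast
    obtain q r where "e = {q, r}" using simple_graph_edgeE[OF GH e(1)] .
    then have "e = {w, q} \<or> e = {w, r}" using e(2) by auto
    then obtain p where p: "{w, p} \<in> H" using e(1) by blast
    have only: "u = p" if "{w, u} \<in> H" for u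
    proof (rule ccontr)
      assume "u \<noteq> p"
      then have "card {{w, u}, {w, p}} = 2" by (auto simp: doubleton_eq_iff)
      moreover have "card {{w, u}, {w, p}} \<le> vertex_degree H w"
        unfolding vertex_degree_def using p that simple_graph_finite_edges[OF GH]
        by (intro card_mono) auto
      ultimately show False using w by linarith
    qed
    have nb: "u = x \<or> u = y \<or> u = p" if "{w, u} \<in> E" for u
      using only[of u] that wV unfolding H_def by blast
    have out: "\<exists>u. {w, u} \<in> E \<and> u \<noteq> s \<and> u \<noteq> p" for s
    proof -
      have "card {s, p} < vertex_degree E w"
        using deg3[OF wV] by (simp add: card_insert_if)
      then show ?thesis
        using exists_neighbour_outside[OF G, of "{s, p}" w] by blast
    qed
    have "{w, x} \<in> E" using out[of y] nb by blast
    moreover have "{w, y} \<in> E" using out[of x] nb by blast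
    moreover have "k = 2"
    proof (rule ccontr)
      assume "k \<noteq> 2"
      then have "card {x, y, p} < vertex_degree E w"
        using deg[OF wV] assms(1) by (simp add: card_insert_if)
      then obtain u where "{w, u} \<in> E" "u \<notin> {x, y, p}"
        using exists_neighbour_outside[OF G, of "{x, y, p}" w] by blast
      then show False using nb by blast
    qed
    moreover have "{w, p} \<in> E" "w \<noteq> x" "w \<noteq> y" "p \<noteq> x" "p \<noteq> y"
      using p unfolding H_def by auto
    ultimately show thesis
      using delete_edge_common_neighbour[OF G _ deg3 xy, of w p] kc that by blast
  qed
qed

theorem connected_delete_matching:
  assumes "k \<ge> 2" and G: "simple_graph V E"
    and deg: "\<And>v. v \<in> V \<Longrightarrow> vertex_degree E v \<ge> k + 1"
    and kc: "k_connected k V E"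
  obtains e f where "e \<in> E" "f \<in> E" "e \<inter> f = {}" "k_connected k V (E - {e, f})"
proof -
  have EV: "\<Union>E \<subseteq> V" using G unfolding simple_graph_def by blast
  have "card V \<ge> k + 1" using kc unfolding k_connected_def by blast
  then have "V \<noteq> {}" by auto
  then obtain v where v: "v \<in> V" by blast
  have "E \<noteq> {}"
  proof
    assume "E = {}"
    then have "vertex_degree E v = 0" unfolding vertex_degree_def by simp
    then show False using deg[OF v] by simp
  qed
  moreover have degE: "vertex_degree E v \<ge> k + 1" if "v \<in> \<Union>E" for v
    using deg[of v] EV that by blast
  moreover have "vertex_degree E v \<ge> 2" if "v \<in> \<Union>E" for v
    using degE[OF that] assms(1) by linarith
  ultimately obtain e where e: "e \<in> E" "k_connected k V (E - {e})"
    using Mader_critical_edges[OF G kc order_refl] by metis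
  obtain x y where xy: "e = {x, y}" "x \<noteq> y" "x \<in> V" "y \<in> V"
    using simple_graph_edgeE[OF G e(1)] .
  have G': "simple_graph V (E - {e})" using simple_graph_subset[OF G] by blast
  have "vertex_degree (E - {e}) v \<ge> k + 1" if "v \<in> V - {x, y}" for v
    using that deg[of v] vertex_degree_delete_other[of v e E] xy(1) by simp
  then obtain f where f: "f \<in> E - {e}" "f \<inter> {x, y} = {}" "k_connected k V (E - {e} - {f})"
    using delete_edge_avoiding_two_vertices[OF assms(1) G' e(2) _ xy(3,4,2)] by blast
  moreover have "E - {e} - {f} = E - {e, f}" by blast
  ultimately show thesis using that[of e f] e xy by auto
qed

section \<open>Deleting a matching of two edges\<close>

lemma matching_of_disjoint_edges:
  assumes "simple_graph V E" "e \<in> E" "f \<in> E" "e \<inter> f = {}"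
  shows "matching E {e, f}" "card {e, f} = 2"
proof -
  have "e \<noteq> f"
    using assms simple_graph_edgeE[OF assms(1,2)] by auto
  then show "card {e, f} = 2" by simp
  show "matching E {e, f}"
    using assms unfolding matching_def by (auto simp: pairwise_def disjnt_def)
qed

theorem theorem1p4:
  fixes k :: nat and V :: "'a set" and E :: "'a set set"
  assumes "k \<ge> 2"
    and "simple_graph V E"
    and "min_degree V E \<ge> k + 1"
  shows "(k_connected k V E \<longrightarrow>
           (\<exists>M. matching E M \<and> card M = 2 \<and> k_connected k V (E - M))) \<and>
         (k_edge_connected k V E \<longrightarrow>
           (\<exists>M. matching E M \<and> card M = 2 \<and> k_edge_connected k V (E - M)))"
proof -
  have deg: "vertex_degree E v \<ge> k + 1" if "v \<in> V" for v
  proof -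
    have "finite V" using assms(2) unfolding simple_graph_def by blast
    then have "min_degree V E \<le> vertex_degree E v"
      unfolding min_degree_def using that by simp
    then show ?thesis using assms(3) by linarith
  qed
  show ?thesis
    using connected_delete_matching[OF assms(1,2) deg]
      edge_connected_delete_matching[OF assms(1,2) deg]
      matching_of_disjoint_edges[OF assms(2)] by metis
qed

end
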